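(* If a graph class $\mathcal{F}$ has a $(\sigma,\tau)$-sparse cover scheme, then $\mathcal{F}$ has a distance-invariant, disjunctive $\sigma$-ADT labelling scheme with labels of size $O(\tau)$ (each label consists of at most $\tau$ equality codes and no prefix).
   Context: The weak diameter of $S\subseteq V(G)$ is $\max_{x,y\in S}\mathsf{dist}_G(x,y)$. $B(u,r)$ is the set of vertices at distance at most $r$ from $u$. A $(\sigma,\tau,\Delta)$-sparse cover of $G$ is a family $\mathcal{C}$ of subsets of $V(G)$, each of weak diameter at most $\Delta$, such that (i) for each $u$ some $C\in\mathcal{C}$ contains $B(u,\Delta/\sigma)$, and (ii) each vertex lies in at most $\tau$ sets of $\mathcal{C}$. $G$ admits a $(\sigma,\tau)$-sparse cover scheme if it has a $(\sigma,\tau,\Delta)$-sparse cover for every $\Delta$; $\mathcal{F}$ has such a scheme if every graph in it does. A distance-invariant disjunctive $\sigma$-ADT labelling scheme: there is a single decoder such that for every $r>0$ and every $G\in\mathcal{F}$ there is a deterministic labelling assigning to each vertex $x$ a vector $\vec q(x)$ of natural numbers (equality codes); the decoder outputs $1$ iff some entry of $\vec q(x)$ equals some entry of $\vec q(y)$ (a disjunction of equality tests); it must output $1$ whenever $\mathsf{dist}_G(x,y)\le r$ and $0$ whenever $\mathsf{dist}_G(x,y)>\sigma r$. *)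

theory Defs
  imports "Graph_Theory.Graph_Theory"
begin

text \<open>
  Graphs are finite, simple and undirected (locale \<^locale>\<open>pair_graph\<close>: a symmetric irreflexive
  arc relation on a finite vertex set).  Every edge has length 1, and vertices in different
  components are at distance \<open>\<infinity>\<close>.
\<close>

definition graph_dist :: "'a pair_pre_digraph \<Rightarrow> 'a \<Rightarrow> 'a \<Rightarrow> ereal" where
  "graph_dist G u v = wf_digraph.\<mu> (with_proj G) (\<lambda>_. 1) u v"

text \<open>
  In a finite graph the supremum is a maximum for nonempty \<open>S\<close>; for \<open>S = {}\<close> it is \<open>-\<infinity>\<close>, so the
  empty set counts as having weak diameter at most any bound.
\<close>

definition weak_diameter :: "'a pair_pre_digraph \<Rightarrow> 'a set \<Rightarrow> ereal" where
  "weak_diameter G S = (SUP (x, y) \<in> S \<times> S. graph_dist G x y)"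

definition graph_ball :: "'a pair_pre_digraph \<Rightarrow> 'a \<Rightarrow> real \<Rightarrow> 'a set" where
  "graph_ball G u \<rho> = {v \<in> pverts G. graph_dist G u v \<le> ereal \<rho>}"

definition sparse_cover ::
    "'a pair_pre_digraph \<Rightarrow> real \<Rightarrow> nat \<Rightarrow> real \<Rightarrow> 'a set set \<Rightarrow> bool" where
  "sparse_cover G \<sigma> \<tau> \<Delta> \<C> \<longleftrightarrow>
     (\<forall>C\<in>\<C>. C \<subseteq> pverts G \<and> weak_diameter G C \<le> ereal \<Delta>) \<and>
     (\<forall>u\<in>pverts G. \<exists>C\<in>\<C>. graph_ball G u (\<Delta> / \<sigma>) \<subseteq> C) \<and>
     (\<forall>v\<in>pverts G. finite {C\<in>\<C>. v \<in> C} \<and> card {C\<in>\<C>. v \<in> C} \<le> \<tau>)"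

definition sparse_cover_scheme :: "'a pair_pre_digraph \<Rightarrow> real \<Rightarrow> nat \<Rightarrow> bool" where
  "sparse_cover_scheme G \<sigma> \<tau> \<longleftrightarrow> (\<forall>\<Delta>>0. \<exists>\<C>. sparse_cover G \<sigma> \<tau> \<Delta> \<C>)"

definition class_sparse_cover_scheme ::
    "'a pair_pre_digraph set \<Rightarrow> real \<Rightarrow> nat \<Rightarrow> bool" where
  "class_sparse_cover_scheme \<F> \<sigma> \<tau> \<longleftrightarrow> (\<forall>G\<in>\<F>. sparse_cover_scheme G \<sigma> \<tau>)"

text \<open>
  A label is a vector of equality codes, with no prefix; its size is its length.
\<close>

type_synonym label = "nat list"

definition disjunctive_decoder :: "(label \<Rightarrow> label \<Rightarrow> bool) \<Rightarrow> bool" where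
  "disjunctive_decoder D \<longleftrightarrow>
     (\<forall>a b. D a b \<longleftrightarrow> (\<exists>i<length a. \<exists>j<length b. a ! i = b ! j))"

definition ADT_labelling ::
    "(label \<Rightarrow> label \<Rightarrow> bool) \<Rightarrow> 'a pair_pre_digraph \<Rightarrow> real \<Rightarrow> real \<Rightarrow> ('a \<Rightarrow> label) \<Rightarrow> bool" where
  "ADT_labelling D G \<sigma> r q \<longleftrightarrow>
     (\<forall>x\<in>pverts G. \<forall>y\<in>pverts G.
        (graph_dist G x y \<le> ereal r \<longrightarrow> D (q x) (q y)) \<and>
        (graph_dist G x y > ereal (\<sigma> * r) \<longrightarrow> \<not> D (q x) (q y)))"

text \<open>
  Distance invariance is the order of the quantifiers: one decoder \<open>D\<close> serves all thresholds \<open>r\<close>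
  (and all graphs of the class), whereas the labelling \<open>q\<close> may depend on both.  The parameter \<open>s\<close>
  bounds the label size.
\<close>

definition distance_invariant_disjunctive_ADT_scheme ::
    "'a pair_pre_digraph set \<Rightarrow> real \<Rightarrow> nat \<Rightarrow> bool" where
  "distance_invariant_disjunctive_ADT_scheme \<F> \<sigma> s \<longleftrightarrow>
     (\<exists>D. disjunctive_decoder D \<and>
        (\<forall>r>0. \<forall>G\<in>\<F>. \<exists>q. (\<forall>x\<in>pverts G. length (q x) \<le> s) \<and> ADT_labelling D G \<sigma> r q))"

end

theory Submission
  imports Defs
begin

text \<open>
  Take a \<open>(\<sigma>, \<tau>, \<sigma> r)\<close>-sparse cover, number its clusters, and label each vertex with the numbers of
  the clusters containing it.  If \<open>x\<close> and \<open>y\<close> are at distance at most \<open>r\<close>, the cluster containing the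
  ball of radius \<open>r\<close> around \<open>x\<close> contains both, so they share a code; conversely, two vertices
  sharing a code lie in a common cluster and hence are at distance at most \<open>\<sigma> r\<close>.
\<close>

text \<open>The empty walk at \<open>u\<close> costs 0. Equality can fail for general
  \<open>f\<close>, since a closed walk through \<open>u\<close> may have negative cost.\<close>

lemma (in wf_digraph) mu_refl_le:
  assumes "u \<in> verts G"
  shows "\<mu> f u u \<le> 0"
proof -
  have "awalk u [] u"
    using assms by (simp add: awalk_Nil_iff)
  then have "\<mu> f u u \<le> awalk_cost f []"
    by (rule min_cost_le_walk_cost)
  then show ?thesis
    by (simp add: zero_ereal_def)
qed

lemma graph_dist_refl_le:
  assumes "pair_graph G" "u \<in> pverts G"
  shows "graph_dist G u u \<le> 0"
proof -
  interpret pair_graph G by fact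
  show ?thesis
    unfolding graph_dist_def using assms(2) by (intro mu_refl_le) simp
qed

lemma center_in_graph_ball:
  assumes "pair_graph G" "u \<in> pverts G" "\<rho> \<ge> 0"
  shows "u \<in> graph_ball G u \<rho>"
  using graph_dist_refl_le[OF assms(1,2)] assms(2,3)
  by (auto simp: graph_ball_def intro: order_trans)

lemma graph_dist_le_weak_diameter:
  assumes "x \<in> S" "y \<in> S"
  shows "graph_dist G x y \<le> weak_diameter G S"
  unfolding weak_diameter_def using assms by (intro SUP_upper2[of "(x, y)"]) auto

text \<open>The case of one graph and one threshold. The decoder is given from outside, so it cannot
  depend on \<open>G\<close> or \<open>r\<close>; only \<open>q\<close> is constructed.\<close>

lemma sparse_cover_ADT_labelling:
  assumes G: "pair_graph G" and \<sigma>: "\<sigma> > 0" and r: "r > 0"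
    and cover: "sparse_cover G \<sigma> \<tau> (\<sigma> * r) \<C>" and D: "disjunctive_decoder D"
  obtains q where "\<And>x. x \<in> pverts G \<Longrightarrow> length (q x) \<le> \<tau>" "ADT_labelling D G \<sigma> r q"
proof -
  have "finite (pverts G)"
  proof -
    interpret pair_graph G by fact
    show ?thesis by simp
  qed
  moreover have "\<C> \<subseteq> Pow (pverts G)"
    using cover by (auto simp: sparse_cover_def)
  ultimately have fin: "finite \<C>"
    by (meson finite_Pow_iff finite_subset)
  obtain code :: "'a set \<Rightarrow> nat" where code: "inj_on code \<C>"
    using finite_imp_inj_to_nat_seg[OF fin] by metis
  \<comment> \<open>Sorting merely turns the set of codes into a vector. Finiteness of
    \<open>\<C>\<close> matters, as \<open>sorted_list_of_set\<close> returns the empty list on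
    infinite sets.\<close>
  define q where "q x = sorted_list_of_set (code ` {C \<in> \<C>. x \<in> C})" for x
  have set_q: "set (q x) = code ` {C \<in> \<C>. x \<in> C}" for x
    using fin by (simp add: q_def)
  have D_iff: "D (q x) (q y) \<longleftrightarrow> (\<exists>C\<in>\<C>. x \<in> C \<and> y \<in> C)" for x y
  proof -
    have "D (q x) (q y) \<longleftrightarrow> set (q x) \<inter> set (q y) \<noteq> {}"
      using D by (force simp: disjunctive_decoder_def in_set_conv_nth)
    \<comment> \<open>By injectivity of \<open>code\<close>, equal codes name the same
      cluster.\<close>
    also have "\<dots> \<longleftrightarrow> (\<exists>C\<in>\<C>. x \<in> C \<and> y \<in> C)"
      using code by (auto simp: set_q dest: inj_onD)
    finally show ?thesis .
  qed
  show thesis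
  proof (rule that)
    fix x assume "x \<in> pverts G"
    then have "card {C \<in> \<C>. x \<in> C} \<le> \<tau>"
      using cover by (simp add: sparse_cover_def)
    moreover have "length (q x) \<le> card {C \<in> \<C>. x \<in> C}"
      using fin by (simp add: q_def card_image_le)
    ultimately show "length (q x) \<le> \<tau>"
      by simp
  next
    show "ADT_labelling D G \<sigma> r q"
      unfolding ADT_labelling_def
    proof (intro ballI conjI impI)
      fix x y assume xy: "x \<in> pverts G" "y \<in> pverts G" and "graph_dist G x y \<le> ereal r"
      then have "y \<in> graph_ball G x r"
        by (simp add: graph_ball_def)
      moreover have "x \<in> graph_ball G x r"
        using G xy r by (simp add: center_in_graph_ball)
      \<comment> \<open>The covered radius is \<open>(\<sigma> * r) / \<sigma> = r\<close>.\<close>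
      moreover obtain C where "C \<in> \<C>" "graph_ball G x r \<subseteq> C"
        using cover xy \<sigma> by (auto simp: sparse_cover_def)
      ultimately show "D (q x) (q y)"
        unfolding D_iff by blast
    next
      fix x y assume far: "ereal (\<sigma> * r) < graph_dist G x y"
      show "\<not> D (q x) (q y)"
      proof
        assume "D (q x) (q y)"
        then obtain C where C: "C \<in> \<C>" "x \<in> C" "y \<in> C"
          unfolding D_iff by blast
        \<comment> \<open>This also settles vertices in different components: their distance is
          infinite, while the weak diameter of \<open>C\<close> has a real bound.\<close>
        have "graph_dist G x y \<le> weak_diameter G C"
          using C by (intro graph_dist_le_weak_diameter)
        also have "\<dots> \<le> ereal (\<sigma> * r)"
          using cover C by (simp add: sparse_cover_def)
        finally show False
          using far by simp
      qed
    qed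
  qed
qed

theorem theorem5p14:
  fixes \<F> :: "'a pair_pre_digraph set" and \<sigma> :: real and \<tau> :: nat
  assumes "\<forall>G\<in>\<F>. pair_graph G"
    and "\<sigma> > 0"
    and "class_sparse_cover_scheme \<F> \<sigma> \<tau>"
  shows "distance_invariant_disjunctive_ADT_scheme \<F> \<sigma> \<tau>"
proof -
  \<comment> \<open>Fixing \<open>D\<close> before any \<open>r\<close> and \<open>G\<close> gives
    distance invariance.\<close>
  define D :: "label \<Rightarrow> label \<Rightarrow> bool"
    where "D a b \<longleftrightarrow> (\<exists>i<length a. \<exists>j<length b. a ! i = b ! j)" for a b
  have D: "disjunctive_decoder D"
    by (simp add: disjunctive_decoder_def D_def)
  have "\<exists>q. (\<forall>x\<in>pverts G. length (q x) \<le> \<tau>) \<and> ADT_labelling D G \<sigma> r q"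
    if r: "r > 0" and G: "G \<in> \<F>" for r G
  proof -
    \<comment> \<open>The scheme provides covers only for positive diameter bounds.\<close>
    have "\<sigma> * r > 0"
      using assms(2) r by simp
    then obtain \<C> where cover: "sparse_cover G \<sigma> \<tau> (\<sigma> * r) \<C>"
      using assms(3) G
      unfolding class_sparse_cover_scheme_def sparse_cover_scheme_def by blast
    have "pair_graph G"
      using assms(1) G by blast
    from this assms(2) r cover D obtain q where
      "\<And>x. x \<in> pverts G \<Longrightarrow> length (q x) \<le> \<tau>" "ADT_labelling D G \<sigma> r q"
      by (rule sparse_cover_ADT_labelling) blast
    then show ?thesis
      by blast
  qed
  with D show ?thesis
    unfolding distance_invariant_disjunctive_ADT_scheme_def by blast
qed

end
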